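(* Let $\mathsf P$ be a piece with basic move set $\mathcal M$, $\mathcal B$ a rational convex polygon, and $q\ge 1$. The number of unlabelled combinatorial types of nonattacking configuration of $q$ pieces is $1$ if $|\mathcal M|=1$, and is $q!$ if $|\mathcal M|=2$.
   Context: $\mathcal M$ is a nonempty finite set of nonzero vectors $m_r=(c_r,d_r)\in\mathbb Z^2$ with $\gcd(c_r,d_r)=1$, no two parallel; $m_r^\perp=(d_r,-c_r)$. $\mathcal B\subset\mathbb R^2$ is a closed two-dimensional convex polygon with rational vertices and interior $\mathcal B^\circ$. For a positive integer $t$, a labelled configuration is $\mathbf z=(z_1,\dots,z_q)$, $z_i\in t\mathcal B^\circ\cap\mathbb Z^2$, nonattacking if $(z_j-z_i)\cdot m_r^\perp\ne 0$ for all $i\ne j$ and all $r$. Its labelled type is the family of sets $L_{ir}=\{j:(z_j-z_i)\cdot m_r^\perp>0\}$, $i=1,\dots,q$, $m_r\in\mathcal M$, taken over nonattacking configurations for all $t$; unlabelled combinatorial types are obtained by forgetting labels (orbits under permutation of the pieces). *)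

theory Defs
  imports "HOL-Analysis.Analysis" "HOL-Combinatorics.Permutations"
begin

definition basic_move_set :: "(int \<times> int) set \<Rightarrow> bool" where
  "basic_move_set M \<longleftrightarrow>
     finite M \<and> M \<noteq> {} \<and>
     (\<forall>(c, d)\<in>M. (c, d) \<noteq> (0, 0) \<and> gcd c d = 1) \<and>
     (\<forall>(c, d)\<in>M. \<forall>(c', d')\<in>M. (c, d) \<noteq> (c', d') \<longrightarrow> c * d' \<noteq> c' * d)"

definition rational_convex_polygon :: "(real \<times> real) set \<Rightarrow> bool" where
  "rational_convex_polygon B \<longleftrightarrow>
     polytope B \<and> aff_dim B = 2 \<and>
     (\<forall>v. v extreme_point_of B \<longrightarrow> fst v \<in> \<rat> \<and> snd v \<in> \<rat>)"

definition dilated_interior_points :: "(real \<times> real) set \<Rightarrow> nat \<Rightarrow> (int \<times> int) set" where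
  "dilated_interior_points B t =
     {p. (real_of_int (fst p), real_of_int (snd p)) \<in> (\<lambda>x. real t *\<^sub>R x) ` interior B}"

text \<open>The value \<open>m\<^sup>\<bottom> \<cdot> v\<close>, where \<open>m\<^sup>\<bottom> = (d, - c)\<close> for \<open>m = (c, d)\<close>.\<close>

definition perp_dot :: "int \<times> int \<Rightarrow> int \<times> int \<Rightarrow> int" where
  "perp_dot m v = snd m * fst v - fst m * snd v"

text \<open>Pieces are labelled by \<open>{1..q}\<close>; \<open>z\<close> is \<open>undefined\<close> outside that set.\<close>

definition nonattacking_configs ::
  "(int \<times> int) set \<Rightarrow> (real \<times> real) set \<Rightarrow> nat \<Rightarrow> nat \<Rightarrow> (nat \<Rightarrow> int \<times> int) set" where
  "nonattacking_configs M B q t =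
     {z \<in> {1..q} \<rightarrow>\<^sub>E dilated_interior_points B t.
        \<forall>i\<in>{1..q}. \<forall>j\<in>{1..q}. i \<noteq> j \<longrightarrow> (\<forall>m\<in>M. perp_dot m (z j - z i) \<noteq> 0)}"

type_synonym labelled_type = "nat \<times> (int \<times> int) \<Rightarrow> nat set"

definition type_of_config ::
  "(int \<times> int) set \<Rightarrow> nat \<Rightarrow> (nat \<Rightarrow> int \<times> int) \<Rightarrow> labelled_type" where
  "type_of_config M q z =
     (\<lambda>(i, m)\<in>{1..q} \<times> M. {j \<in> {1..q}. perp_dot m (z j - z i) > 0})"

definition labelled_types ::
  "(int \<times> int) set \<Rightarrow> (real \<times> real) set \<Rightarrow> nat \<Rightarrow> labelled_type set" where
  "labelled_types M B q =
     (\<Union>t\<in>{t. t > 0}. type_of_config M q ` nonattacking_configs M B q t)"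

text \<open>Renaming every piece \<open>i\<close> to \<open>\<pi> i\<close>: \<open>L' (\<pi> i, m) = \<pi> ` L (i, m)\<close>.\<close>

definition relabel ::
  "(int \<times> int) set \<Rightarrow> nat \<Rightarrow> (nat \<Rightarrow> nat) \<Rightarrow> labelled_type \<Rightarrow> labelled_type" where
  "relabel M q \<pi> L = (\<lambda>(i, m)\<in>{1..q} \<times> M. \<pi> ` L (inv \<pi> i, m))"

lemma type_of_config_permuted:
  assumes "\<pi> permutes {1..q}"
  shows "type_of_config M q (z \<circ> inv \<pi>) = relabel M q \<pi> (type_of_config M q z)"
proof
  fix x :: "nat \<times> int \<times> int"
  obtain i m where x: "x = (i, m)" by (cases x)
  have img: "\<pi> ` {j \<in> {1..q}. P j} = {j \<in> {1..q}. P (inv \<pi> j)}" for P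
  proof (intro set_eqI iffI)
    fix k assume k: "k \<in> {j \<in> {1..q}. P (inv \<pi> j)}"
    have "inv \<pi> k \<in> {1..q}"
      using k permutes_in_image[OF permutes_inv[OF assms], of k] by blast
    then have "inv \<pi> k \<in> {j \<in> {1..q}. P j}" using k by blast
    then have "\<pi> (inv \<pi> k) \<in> \<pi> ` {j \<in> {1..q}. P j}" by (rule imageI)
    then show "k \<in> \<pi> ` {j \<in> {1..q}. P j}"
      by (simp only: permutes_inverses(1)[OF assms])
  next
    fix k assume "k \<in> \<pi> ` {j \<in> {1..q}. P j}"
    then obtain j where j: "k = \<pi> j" "j \<in> {1..q}" "P j" by blast
    have "\<pi> j \<in> {1..q}" using j(2) permutes_in_image[OF assms, of j] by blast
    then show "k \<in> {j \<in> {1..q}. P (inv \<pi> j)}"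
      unfolding j(1) using j(3) by (simp only: mem_Collect_eq permutes_inverses(2)[OF assms] simp_thms)
  qed
  show "type_of_config M q (z \<circ> inv \<pi>) x = relabel M q \<pi> (type_of_config M q z) x"
  proof (cases "x \<in> {1..q} \<times> M")
    case True
    then have "i \<in> {1..q}" "m \<in> M" using x by (blast, blast)
    moreover from this have "inv \<pi> i \<in> {1..q}"
      using permutes_in_image[OF permutes_inv[OF assms], of i] by blast
    ultimately show ?thesis
      unfolding type_of_config_def relabel_def restrict_def x
      by (simp only: mem_Sigma_iff split_conv img o_apply simp_thms if_True)
  next
    case False
    then show ?thesis by (simp only: type_of_config_def relabel_def restrict_def if_False)
  qed
qed

definition unlabelled_types ::
  "(int \<times> int) set \<Rightarrow> (real \<times> real) set \<Rightarrow> nat \<Rightarrow> labelled_type set set" where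
  "unlabelled_types M B q =
     (\<lambda>L. {relabel M q \<pi> L | \<pi>. \<pi> permutes {1..q}}) ` labelled_types M B q"

end

theory Submission
  imports Defs "HOL-Real_Asymp.Real_Asymp"
begin

text \<open>
  For each move \<open>m\<close>, the values \<open>m\<^sup>\<bottom> \<cdot> z\<^sub>i\<close> are distinct, so a labelled type amounts to
  a linear order of the pieces, that is to a permutation of \<open>{1..q}\<close>, for each move. With at most
  two moves the two linear forms are independent and any pair of permutations is realised by lattice
  points, which fit into \<open>t\<B>\<^sup>\<circ>\<close> for large \<open>t\<close>. Relabelling composes all the permutations
  with the same permutation on the right, so the first one can be normalised to the identity and the
  second one is then a complete invariant of the orbit.
\<close>

section \<open>Ranks: linear orders of the pieces as permutations\<close>

lemma perp_dot_diff: "perp_dot m (u - v) = perp_dot m u - perp_dot m v"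
  by (simp add: perp_dot_def algebra_simps)

text \<open>Counting the elements whose value is at most \<open>f i\<close> gives the rank of
  \<open>i\<close>. A larger value has a strictly larger down-set, so ranks are strictly increasing
  in \<open>f\<close>, and an injective map of a finite set into itself is bijective.\<close>

lemma ex_permutes_order_iso:
  fixes f :: "nat \<Rightarrow> 'a::linorder"
  assumes "inj_on f {1..q}"
  shows "\<exists>g. g permutes {1..q} \<and> (\<forall>i\<in>{1..q}. \<forall>j\<in>{1..q}. g i < g j \<longleftrightarrow> f i < f j)"
proof -
  \<comment> \<open>The weak inequality counts \<open>i\<close> itself, so ranks start at 1. Points
    outside \<open>{1..q}\<close> must be fixed for \<open>g\<close> to satisfy
    \<open>permutes\<close>.\<close>
  define g where "g i = (if i \<in> {1..q} then card {j\<in>{1..q}. f j \<le> f i} else i)" for i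
  have less: "g i < g j" if "i \<in> {1..q}" "j \<in> {1..q}" "f i < f j" for i j
  proof -
    have "j \<in> {k\<in>{1..q}. f k \<le> f j} - {k\<in>{1..q}. f k \<le> f i}"
      using that by auto
    moreover have "{k\<in>{1..q}. f k \<le> f i} \<subseteq> {k\<in>{1..q}. f k \<le> f j}"
      using that by auto
    ultimately have "{k\<in>{1..q}. f k \<le> f i} \<subset> {k\<in>{1..q}. f k \<le> f j}"
      by blast
    then have "card {k\<in>{1..q}. f k \<le> f i} < card {k\<in>{1..q}. f k \<le> f j}"
      by (intro psubset_card_mono) auto
    then show ?thesis
      using that by (simp add: g_def)
  qed
  have iff: "g i < g j \<longleftrightarrow> f i < f j" if "i \<in> {1..q}" "j \<in> {1..q}" for i j
    using less[OF that] less[OF that(2,1)] that assms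
    by (metis inj_onD less_asym linorder_neqE order_less_irrefl)
  have inj: "inj_on g {1..q}"
    using iff assms by (metis inj_on_def linorder_neqE order_less_irrefl)
  have "g i \<in> {1..q}" if i: "i \<in> {1..q}" for i
  proof -
    have "card {j\<in>{1..q}. f j \<le> f i} \<le> card {1..q}"
      by (intro card_mono) auto
    moreover have "0 < card {j\<in>{1..q}. f j \<le> f i}"
      using i by (auto simp: card_gt_0_iff)
    ultimately show ?thesis
      using i by (simp add: g_def)
  qed
  then have "g ` {1..q} \<subseteq> {1..q}"
    by blast
  then have "bij_betw g {1..q} {1..q}"
    using inj by (simp add: bij_betw_def endo_inj_surj)
  then have "g permutes {1..q}"
    by (rule bij_imp_permutes) (simp only: g_def if_False)
  with iff show ?thesis
    by blast
qed

text \<open>\<open>g\<close> maps this set bijectively onto the interval \<open>{g i <.. q}\<close>.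
  The size of a set in a labelled type thus reveals the rank of its piece.\<close>

lemma card_permutes_greater:
  assumes "g permutes {1..q}" "i \<in> {1..q}"
  shows "card {j \<in> {1..q}. g i < g j} = q - g i"
proof -
  have "g ` {j \<in> {1..q}. g i < g j} = {g i <.. q}"
  proof (intro set_eqI iffI)
    fix k assume "k \<in> g ` {j \<in> {1..q}. g i < g j}"
    then show "k \<in> {g i <.. q}"
      using permutes_in_image[OF assms(1)] by fastforce
  next
    fix k assume k: "k \<in> {g i <.. q}"
    then have "k \<in> {1..q}"
      by auto
    then have "k \<in> g ` {1..q}"
      using permutes_image[OF assms(1)] by blast
    then show "k \<in> g ` {j \<in> {1..q}. g i < g j}"
      using k by auto
  qed
  then show ?thesis
    using card_image[OF inj_on_subset[OF permutes_inj[OF assms(1)] subset_UNIV],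
        of "{j \<in> {1..q}. g i < g j}"] by simp
qed

section \<open>Order types and the action of relabelling on them\<close>

definition order_type ::
  "(int \<times> int) set \<Rightarrow> nat \<Rightarrow> (int \<times> int \<Rightarrow> nat \<Rightarrow> nat) \<Rightarrow> labelled_type" where
  "order_type M q g = (\<lambda>(i, m)\<in>{1..q} \<times> M. {j \<in> {1..q}. g m i < g m j})"

text \<open>On \<open>{1..q}\<close> the rank \<open>g m i\<close> is recovered from the size
  \<open>q - g m i\<close> of the set at \<open>(i, m)\<close>; elsewhere both permutations are the
  identity.\<close>

lemma order_type_eq_iff:
  assumes "\<And>m. m \<in> M \<Longrightarrow> g m permutes {1..q}" "\<And>m. m \<in> M \<Longrightarrow> h m permutes {1..q}"
  shows "order_type M q g = order_type M q h \<longleftrightarrow> (\<forall>m\<in>M. g m = h m)"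
proof
  assume eq: "order_type M q g = order_type M q h"
  show "\<forall>m\<in>M. g m = h m"
  proof (intro ballI ext)
    fix m i assume m: "m \<in> M"
    show "g m i = h m i"
    proof (cases "i \<in> {1..q}")
      case True
      have "{j \<in> {1..q}. g m i < g m j} = {j \<in> {1..q}. h m i < h m j}"
        using fun_cong[OF eq, of "(i, m)"] True m by (simp add: order_type_def)
      then have "q - g m i = q - h m i"
        using card_permutes_greater assms m True by metis
      \<comment> \<open>Subtraction on naturals truncates, so these bounds are needed to cancel
        \<open>q\<close>.\<close>
      moreover have "g m i \<le> q" "h m i \<le> q"
        using permutes_in_image[OF assms(1)[OF m], of i]
          permutes_in_image[OF assms(2)[OF m], of i] True by auto
      ultimately show ?thesis
        by linarith
    next
      case False
      then show ?thesis
        using assms[OF m] by (metis permutes_not_in)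
    qed
  qed
next
  assume "\<forall>m\<in>M. g m = h m"
  then show "order_type M q g = order_type M q h"
    unfolding order_type_def by (intro restrict_ext) auto
qed

text \<open>Substituting \<open>inv \<pi> k\<close> for \<open>j\<close> describes the image under
  \<open>\<pi>\<close>: a renamed piece keeps the rank of the piece it came from.\<close>

lemma relabel_order_type:
  assumes \<pi>: "\<pi> permutes {1..q}"
  shows "relabel M q \<pi> (order_type M q g) = order_type M q (\<lambda>m. g m \<circ> inv \<pi>)"
proof
  fix x :: "nat \<times> int \<times> int"
  obtain i m where x: "x = (i, m)"
    by (cases x)
  have inv: "inv \<pi> permutes {1..q}"
    using \<pi> by (rule permutes_inv)
  have "\<pi> ` {j \<in> {1..q}. g m (inv \<pi> i) < g m j}
      = {j \<in> {1..q}. g m (inv \<pi> i) < g m (inv \<pi> j)}"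
  proof (intro set_eqI iffI)
    fix k assume "k \<in> \<pi> ` {j \<in> {1..q}. g m (inv \<pi> i) < g m j}"
    then show "k \<in> {j \<in> {1..q}. g m (inv \<pi> i) < g m (inv \<pi> j)}"
      using permutes_in_image[OF \<pi>] permutes_inverses(2)[OF \<pi>] by auto
  next
    fix k assume "k \<in> {j \<in> {1..q}. g m (inv \<pi> i) < g m (inv \<pi> j)}"
    then have "inv \<pi> k \<in> {j \<in> {1..q}. g m (inv \<pi> i) < g m j}"
      using permutes_in_image[OF inv, of k] by auto
    then show "k \<in> \<pi> ` {j \<in> {1..q}. g m (inv \<pi> i) < g m j}"
      using permutes_inverses(1)[OF \<pi>, of k] by (metis imageI)
  qed
  then show "relabel M q \<pi> (order_type M q g) x = order_type M q (\<lambda>m. g m \<circ> inv \<pi>) x"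
    using permutes_in_image[OF inv, of i] by (auto simp: x relabel_def order_type_def)
qed

text \<open>As \<open>\<pi>\<close> runs through the group, so does \<open>inv \<pi>\<close>; this
  removes the inverse from the description of orbits.\<close>

lemma relabel_orbit_order_type:
  "{relabel M q \<pi> (order_type M q g) | \<pi>. \<pi> permutes {1..q}}
     = {order_type M q (\<lambda>m. g m \<circ> \<rho>) | \<rho>. \<rho> permutes {1..q}}"
  (is "?L = ?R")
proof (intro equalityI subsetI)
  fix x assume "x \<in> ?L"
  then show "x \<in> ?R"
    using relabel_order_type permutes_inv by blast
next
  fix x assume "x \<in> ?R"
  then obtain \<rho> where \<rho>: "x = order_type M q (\<lambda>m. g m \<circ> \<rho>)" "\<rho> permutes {1..q}"
    by auto
  then have "x = relabel M q (inv \<rho>) (order_type M q g)"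
    by (simp only: relabel_order_type permutes_inv permutes_inv_inv)
  then show "x \<in> ?L"
    using permutes_inv[OF \<rho>(2)] by blast
qed

text \<open>Left multiplication by \<open>\<rho>\<close> permutes the group, so both sides range
  over the same compositions. This is what permits normalising a family of ranks inside its
  orbit.\<close>

lemma order_type_orbit_comp:
  assumes "\<rho> permutes {1..q}"
  shows "{order_type M q (\<lambda>m. (g m \<circ> \<rho>) \<circ> \<tau>) | \<tau>. \<tau> permutes {1..q}}
     = {order_type M q (\<lambda>m. g m \<circ> \<tau>) | \<tau>. \<tau> permutes {1..q}}" (is "?L = ?R")
proof (intro equalityI subsetI)
  fix x assume "x \<in> ?L"
  then obtain \<tau> where "x = order_type M q (\<lambda>m. g m \<circ> (\<rho> \<circ> \<tau>))" "\<tau> permutes {1..q}"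
    by (auto simp: o_assoc)
  then show "x \<in> ?R"
    using permutes_compose[of \<tau> "{1..q}" \<rho>] assms by blast
next
  fix x assume "x \<in> ?R"
  then obtain \<tau> where \<tau>: "x = order_type M q (\<lambda>m. g m \<circ> \<tau>)" "\<tau> permutes {1..q}"
    by auto
  have "(g m \<circ> \<rho>) \<circ> (inv \<rho> \<circ> \<tau>) = g m \<circ> \<tau>" for m :: "int \<times> int"
    using permutes_inverses(1)[OF assms] by (simp add: fun_eq_iff)
  then have "x = order_type M q (\<lambda>m. (g m \<circ> \<rho>) \<circ> (inv \<rho> \<circ> \<tau>))"
    using \<tau>(1) by simp
  then show "x \<in> ?L"
    using permutes_compose[OF \<tau>(2) permutes_inv[OF assms]] by blast
qed

lemma order_type_orbit_cong:
  assumes "\<And>m. m \<in> M \<Longrightarrow> g m = h m"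
  shows "{order_type M q (\<lambda>m. g m \<circ> \<tau>) | \<tau>. \<tau> permutes {1..q}}
     = {order_type M q (\<lambda>m. h m \<circ> \<tau>) | \<tau>. \<tau> permutes {1..q}}"
proof -
  have "order_type M q (\<lambda>m. g m \<circ> \<tau>) = order_type M q (\<lambda>m. h m \<circ> \<tau>)" for \<tau>
    unfolding order_type_def using assms by (intro restrict_ext) auto
  then show ?thesis
    by simp
qed

section \<open>Labelled types are order types\<close>

lemma type_of_config_eq_order_type:
  assumes "\<And>m i j. m \<in> M \<Longrightarrow> i \<in> {1..q} \<Longrightarrow> j \<in> {1..q} \<Longrightarrow>
    0 < perp_dot m (z j - z i) \<longleftrightarrow> g m i < g m j"
  shows "type_of_config M q z = order_type M q g"
  using assms unfolding type_of_config_def order_type_def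
  by (intro restrict_ext) auto

text \<open>In a nonattacking configuration each form \<open>perp_dot m\<close> is injective on the
  pieces, so its values can be replaced by ranks, one permutation chosen per move.\<close>

lemma labelled_types_subset_order_types:
  "labelled_types M B q \<subseteq> {order_type M q g | g. \<forall>m\<in>M. g m permutes {1..q}}"
proof
  fix L assume "L \<in> labelled_types M B q"
  then obtain t z where L: "L = type_of_config M q z" and z: "z \<in> nonattacking_configs M B q t"
    by (auto simp: labelled_types_def)
  have "\<forall>m\<in>M. \<exists>g. g permutes {1..q} \<and> (\<forall>i\<in>{1..q}. \<forall>j\<in>{1..q}.
      g i < g j \<longleftrightarrow> perp_dot m (z i) < perp_dot m (z j))"
    using z by (intro ballI ex_permutes_order_iso)
      (fastforce simp: inj_on_def nonattacking_configs_def perp_dot_diff)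
  then obtain g where g: "\<forall>m\<in>M. g m permutes {1..q} \<and> (\<forall>i\<in>{1..q}. \<forall>j\<in>{1..q}.
      g m i < g m j \<longleftrightarrow> perp_dot m (z i) < perp_dot m (z j))"
    by metis
  then have "L = order_type M q g"
    unfolding L by (intro type_of_config_eq_order_type) (simp add: perp_dot_diff)
  then show "L \<in> {order_type M q g | g. \<forall>m\<in>M. g m permutes {1..q}}"
    using g by blast
qed

section \<open>Realising order types by lattice points in a dilate\<close>

text \<open>Affine dimension 2 is that of the whole plane, so the interior is the relative interior,
  which is nonempty for a nonempty convex set.\<close>

lemma interior_rational_convex_polygon:
  assumes "rational_convex_polygon B"
  shows "interior B \<noteq> {}"
proof -
  have "convex B" "aff_dim B = int (DIM(real \<times> real))"
    using assms by (auto simp: rational_convex_polygon_def polytope_imp_convex)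
  then show ?thesis
    using rel_interior_eq_empty interior_rel_interior_gen[of B] by fastforce
qed

text \<open>Take for \<open>w\<close> the dilate by \<open>t\<close> of an interior point, rounded
  down. After division by \<open>t\<close> both the rounding error and a fixed vector
  \<open>v\<close> vanish in the limit, so openness of the interior handles each \<open>v\<close>
  for large \<open>t\<close>, and finiteness of \<open>F\<close> handles all at once.\<close>

lemma dilated_interior_contains_translate:
  assumes "interior B \<noteq> {}" "finite F"
  shows "\<exists>t w. t > 0 \<and> (\<forall>v\<in>F. w + v \<in> dilated_interior_points B t)"
proof -
  obtain x y where xy: "(x, y) \<in> interior B"
    using assms(1) by auto
  define w where "w t = (\<lfloor>real t * x\<rfloor>, \<lfloor>real t * y\<rfloor>)" for t :: nat
  have "\<forall>\<^sub>F t in sequentially. w t + v \<in> dilated_interior_points B t" for v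
  proof -
    have lim: "(\<lambda>t. (real_of_int \<lfloor>real t * r\<rfloor> + c) / real t) \<longlonglongrightarrow> r" for r c :: real
      by real_asymp
    define p where "p t = ((real_of_int \<lfloor>real t * x\<rfloor> + real_of_int (fst v)) / real t,
        (real_of_int \<lfloor>real t * y\<rfloor> + real_of_int (snd v)) / real t)" for t
    have "p \<longlonglongrightarrow> (x, y)"
      unfolding p_def by (intro tendsto_Pair lim)
    then have "\<forall>\<^sub>F t in sequentially. p t \<in> interior B"
      using xy topological_tendstoD open_interior by blast
    then show ?thesis
      using eventually_gt_at_top[of 0]
    proof eventually_elim
      case (elim t)
      then have "(real_of_int (fst (w t + v)), real_of_int (snd (w t + v))) = real t *\<^sub>R p t"
        by (simp add: p_def w_def)
      then show ?case
        unfolding dilated_interior_points_def mem_Collect_eq using elim(1) by (rule image_eqI)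
    qed
  qed
  then have "\<forall>\<^sub>F t in sequentially. \<forall>v\<in>F. w t + v \<in> dilated_interior_points B t"
    using assms(2) by (simp add: eventually_ball_finite)
  then have "\<forall>\<^sub>F t in sequentially. t > 0 \<and> (\<forall>v\<in>F. w t + v \<in> dilated_interior_points B t)"
    using eventually_gt_at_top[of 0] by eventually_elim blast
  then show ?thesis
    using eventually_happens' sequentially_bot by blast
qed

text \<open>Two independent forms can be prescribed independently. Stating this for
  \<open>M \<subseteq> {a, b}\<close> covers one move too, with \<open>b\<close> an auxiliary
  vector.\<close>

lemma order_type_in_labelled_types:
  assumes B: "interior B \<noteq> {}" and M: "M \<subseteq> {a, b}" and ab: "perp_dot a b \<noteq> 0"
    and g: "g a permutes {1..q}" "g b permutes {1..q}"
  shows "order_type M q g \<in> labelled_types M B q"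
proof -
  define D where "D = perp_dot a b"
  \<comment> \<open>Since \<open>perp_dot\<close> is alternating, \<open>perp_dot a (v i)\<close> is
    \<open>D\<^sup>2 * int (g a i)\<close> and \<open>perp_dot b (v i)\<close> is
    \<open>D\<^sup>2 * int (g b i)\<close>. The extra factor \<open>D\<close> makes the scale
    positive whatever the sign of \<open>D\<close>.\<close>
  define v where "v i = (D * (int (g a i) * fst b - int (g b i) * fst a),
      D * (int (g a i) * snd b - int (g b i) * snd a))" for i
  obtain t w where "t > 0" and w: "\<forall>u\<in>v ` {1..q}. w + u \<in> dilated_interior_points B t"
    using dilated_interior_contains_translate[OF B, of "v ` {1..q}"] by auto
  \<comment> \<open>The translation \<open>w\<close> cancels in all differences, so it leaves the
    type unchanged.\<close>
  define z where "z = restrict (\<lambda>i. w + v i) {1..q}"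
  have dot: "perp_dot m (z j - z i) = D\<^sup>2 * (int (g m j) - int (g m i))"
    if "m \<in> M" "i \<in> {1..q}" "j \<in> {1..q}" for m i j
  proof -
    have "z j - z i = v j - v i"
      using that by (simp add: z_def)
    moreover have "m = a \<or> m = b"
      using M that by auto
    ultimately show ?thesis
      by (auto simp: v_def D_def perp_dot_def power2_eq_square algebra_simps)
  qed
  have inj: "g m i \<noteq> g m j" if "m \<in> M" "i \<noteq> j" for m i j
    using that M g permutes_inj by (metis injD insertE singletonD subsetD)
  have "z \<in> nonattacking_configs M B q t"
    unfolding nonattacking_configs_def
    using w inj ab dot by (auto simp: z_def D_def)
  moreover have "type_of_config M q z = order_type M q g"
    using ab by (intro type_of_config_eq_order_type)
      (simp add: dot D_def zero_less_mult_iff)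
  ultimately show ?thesis
    unfolding labelled_types_def using \<open>t > 0\<close> by (force intro: rev_image_eqI)
qed

section \<open>Counting the orbits\<close>

lemma unlabelled_types_eq:
  assumes "interior B \<noteq> {}" "M \<subseteq> {a, b}" "perp_dot a b \<noteq> 0"
  shows "unlabelled_types M B q =
    (\<lambda>g. {order_type M q (\<lambda>m. g m \<circ> \<rho>) | \<rho>. \<rho> permutes {1..q}}) `
      {g. \<forall>m. g m permutes {1..q}}"
proof -
  have "labelled_types M B q = order_type M q ` {g. \<forall>m. g m permutes {1..q}}"
  proof (intro equalityI subsetI)
    fix L assume "L \<in> labelled_types M B q"
    then obtain g where L: "L = order_type M q g" and g: "\<forall>m\<in>M. g m permutes {1..q}"
      using labelled_types_subset_order_types by blast
    \<comment> \<open>An order type ignores \<open>g\<close> off \<open>M\<close>; filling in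
      \<open>id\<close> there allows quantifying over all \<open>m\<close>.\<close>
    have "L = order_type M q (\<lambda>m. if m \<in> M then g m else id)"
      unfolding L using g by (subst order_type_eq_iff) auto
    then show "L \<in> order_type M q ` {g. \<forall>m. g m permutes {1..q}}"
      using g by (intro image_eqI) (auto simp: permutes_id)
  next
    fix L assume "L \<in> order_type M q ` {g. \<forall>m. g m permutes {1..q}}"
    then show "L \<in> labelled_types M B q"
      using order_type_in_labelled_types[OF assms] by blast
  qed
  then show ?thesis
    unfolding unlabelled_types_def by (simp only: image_image relabel_orbit_order_type)
qed

lemma card_unlabelled_types_one_move:
  assumes "interior B \<noteq> {}" "a \<noteq> (0, 0)"
  shows "card (unlabelled_types {a} B q) = 1"
proof -
  define orb where
    "orb g = {order_type {a} q (\<lambda>m. g m \<circ> \<rho>) | \<rho>. \<rho> permutes {1..q}}" for g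
  \<comment> \<open>The vector perpendicular to \<open>a\<close> serves as the auxiliary second
    direction; its \<open>perp_dot\<close> with \<open>a\<close> is this sum of squares.\<close>
  have "(snd a)\<^sup>2 + (fst a)\<^sup>2 \<noteq> 0"
    using assms(2) by (cases a) (auto simp: sum_power2_eq_zero_iff)
  then have "perp_dot a (snd a, - fst a) \<noteq> 0"
    by (simp add: perp_dot_def power2_eq_square)
  then have types: "unlabelled_types {a} B q = orb ` {g. \<forall>m. g m permutes {1..q}}"
    using unlabelled_types_eq[OF assms(1), of "{a}" a] by (simp add: orb_def)
  have "orb g = orb (\<lambda>_. id)" if g: "\<forall>m. g m permutes {1..q}" for g
  proof -
    have "orb g = {order_type {a} q (\<lambda>m. (g m \<circ> inv (g a)) \<circ> \<tau>) | \<tau>. \<tau> permutes {1..q}}"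
      unfolding orb_def by (rule order_type_orbit_comp[OF permutes_inv[OF spec[OF g]], symmetric])
    also have "\<dots> = orb (\<lambda>_. id)"
      unfolding orb_def by (rule order_type_orbit_cong) (simp add: permutes_inv_o(1)[OF spec[OF g]])
    finally show ?thesis .
  qed
  moreover have "(\<lambda>_. id) \<in> {g. \<forall>m. g m permutes {1..q}}"
    by (simp add: permutes_id)
  ultimately have "unlabelled_types {a} B q = {orb (\<lambda>_. id)}"
    unfolding types by blast
  then show ?thesis
    by simp
qed

text \<open>Each orbit contains exactly one normal form \<open>G \<sigma>\<close>, with the identity
  at \<open>a\<close> and \<open>\<sigma>\<close> at \<open>b\<close>, so orbits correspond to
  permutations.\<close>

lemma card_unlabelled_types_two_moves:
  assumes "interior B \<noteq> {}" "perp_dot a b \<noteq> 0"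
  shows "card (unlabelled_types {a, b} B q) = fact q"
proof -
  define orb where
    "orb g = {order_type {a, b} q (\<lambda>m. g m \<circ> \<rho>) | \<rho>. \<rho> permutes {1..q}}" for g
  define G where "G \<sigma> m = (if m = a then id else \<sigma>)" for \<sigma> :: "nat \<Rightarrow> nat" and m
  have types: "unlabelled_types {a, b} B q = orb ` {g. \<forall>m. g m permutes {1..q}}"
    using unlabelled_types_eq[OF assms(1) _ assms(2), of "{a, b}"] by (simp add: orb_def)
  have "b \<noteq> a"
    using assms(2) by (auto simp: perp_dot_def)
  have G: "G \<sigma> m permutes {1..q}" if "\<sigma> permutes {1..q}" for \<sigma> m
    using that by (simp add: G_def permutes_id)
  have "inj_on (\<lambda>\<sigma>. orb (G \<sigma>)) {\<sigma>. \<sigma> permutes {1..q}}"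
  proof (intro inj_onI; unfold mem_Collect_eq)
    fix \<sigma> \<tau> assume \<sigma>: "\<sigma> permutes {1..q}" and \<tau>: "\<tau> permutes {1..q}"
      and "orb (G \<sigma>) = orb (G \<tau>)"
    moreover have "order_type {a, b} q (\<lambda>m. G \<sigma> m \<circ> id) \<in> orb (G \<sigma>)"
      unfolding orb_def using permutes_id by blast
    ultimately obtain \<rho> where \<rho>: "\<rho> permutes {1..q}"
      and eq: "order_type {a, b} q (\<lambda>m. G \<sigma> m \<circ> id) = order_type {a, b} q (\<lambda>m. G \<tau> m \<circ> \<rho>)"
      unfolding orb_def by auto
    \<comment> \<open>At \<open>a\<close> this forces \<open>\<rho>\<close> to be the identity; at
      \<open>b\<close> it then gives \<open>\<sigma> = \<tau>\<close>.\<close>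
    have "\<forall>m\<in>{a, b}. G \<sigma> m \<circ> id = G \<tau> m \<circ> \<rho>"
      by (rule order_type_eq_iff[THEN iffD1, OF _ _ eq])
        (intro permutes_compose permutes_id G \<sigma> \<tau> \<rho>)+
    then show "\<sigma> = \<tau>"
      using \<open>b \<noteq> a\<close> by (auto simp: G_def)
  qed
  moreover have "orb ` {g. \<forall>m. g m permutes {1..q}} = (\<lambda>\<sigma>. orb (G \<sigma>)) ` {\<sigma>. \<sigma> permutes {1..q}}"
  proof (intro equalityI subsetI)
    fix x assume "x \<in> orb ` {g. \<forall>m. g m permutes {1..q}}"
    then obtain g where x: "x = orb g" and g: "\<forall>m. g m permutes {1..q}"
      by auto
    \<comment> \<open>This quotient does not change when \<open>g a\<close> and \<open>g b\<close>
      are composed on the right with the same permutation, so it is an invariant of the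
      orbit.\<close>
    define \<sigma> where "\<sigma> = g b \<circ> inv (g a)"
    have \<sigma>: "\<sigma> permutes {1..q}"
      unfolding \<sigma>_def by (intro permutes_compose permutes_inv spec[OF g])
    have "x = {order_type {a, b} q (\<lambda>m. (g m \<circ> inv (g a)) \<circ> \<tau>) | \<tau>. \<tau> permutes {1..q}}"
      unfolding x orb_def
      by (rule order_type_orbit_comp[OF permutes_inv[OF spec[OF g]], symmetric])
    also have "\<dots> = orb (G \<sigma>)"
      unfolding orb_def by (rule order_type_orbit_cong)
        (auto simp: G_def \<sigma>_def permutes_inv_o(1)[OF spec[OF g]])
    finally show "x \<in> (\<lambda>\<sigma>. orb (G \<sigma>)) ` {\<sigma>. \<sigma> permutes {1..q}}"
      using \<sigma> by blast
  next
    fix x assume "x \<in> (\<lambda>\<sigma>. orb (G \<sigma>)) ` {\<sigma>. \<sigma> permutes {1..q}}"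
    then show "x \<in> orb ` {g. \<forall>m. g m permutes {1..q}}"
      using G by blast
  qed
  ultimately show ?thesis
    by (simp add: types card_image card_permutations)
qed

theorem theorem5p8:
  fixes M :: "(int \<times> int) set" and B :: "(real \<times> real) set" and q :: nat
  assumes "basic_move_set M"
    and "rational_convex_polygon B"
    and "q \<ge> 1"
  shows "(card M = 1 \<longrightarrow> card (unlabelled_types M B q) = 1) \<and>
         (card M = 2 \<longrightarrow> card (unlabelled_types M B q) = fact q)"
proof (intro conjI impI)
  note B = interior_rational_convex_polygon[OF assms(2)]
  {
    assume "card M = 1"
    then obtain a where "M = {a}"
      by (auto simp: card_1_singleton_iff)
    moreover from this have "a \<noteq> (0, 0)"
      using assms(1) by (auto simp: basic_move_set_def)
    ultimately show "card (unlabelled_types M B q) = 1"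
      using card_unlabelled_types_one_move[OF B] by simp
  next
    assume "card M = 2"
    then obtain a b where M: "M = {a, b}" and "a \<noteq> b"
      by (auto simp: card_2_iff)
    then have "fst a * snd b \<noteq> fst b * snd a"
      using assms(1) by (cases a; cases b) (auto simp: basic_move_set_def)
    then have "perp_dot a b \<noteq> 0"
      by (simp add: perp_dot_def mult.commute)
    then show "card (unlabelled_types M B q) = fact q"
      using card_unlabelled_types_two_moves[OF B] by (simp add: M)
  }
qed

end
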